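(* Let $G$ be a weighted undirected graph on $N$ vertices, let $T\ge1$, let $\boldsymbol{X}$ be a jointly wide-sense stationary (JWSS) process on $G$ with $T$ time-steps and joint power spectral density (JPSD) $h_{\boldsymbol{X}}$, and let $f(\boldsymbol{L}_J)$ be a joint filter with frequency response $f:\mathbb{R}_+\times\mathbb{R}\to\mathbb{R}$. Let $\boldsymbol{Y}$ be the result of applying $f(\boldsymbol{L}_J)$ to $\boldsymbol{X}$, i.e. $\mathrm{vec}(\boldsymbol{Y})=f(\boldsymbol{L}_J)\,\mathrm{vec}(\boldsymbol{X})$. Then $\boldsymbol{Y}$ is JWSS, with mean $\mathbb{E}[\boldsymbol{Y}]=f(0,0)\,\mathbb{E}[\boldsymbol{X}]$ and JPSD $$h_{\boldsymbol{Y}}(\lambda,\omega)=f^2(\lambda,\omega)\cdot h_{\boldsymbol{X}}(\lambda,\omega).$$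
   Context: Graph. $G$ has vertices $v_1,\dots,v_N$ and symmetric weighted adjacency matrix $\boldsymbol{W}_G$ (nonnegative weights). Its combinatorial Laplacian is $\boldsymbol{L}_G=\mathrm{diag}(\boldsymbol{W}_G\boldsymbol{1}_N)-\boldsymbol{W}_G=\boldsymbol{U}_G\boldsymbol{\Lambda}_G\boldsymbol{U}_G^*$, where $\boldsymbol{U}_G$ is the (unitary) eigenvector matrix and $\boldsymbol{\Lambda}_G=\mathrm{diag}(\lambda_1,\dots,\lambda_N)$. $(\cdot)^*$ is the conjugate transpose. Time. $\boldsymbol{U}_T$ is the $T\times T$ unitary Fourier basis, $[\boldsymbol{U}_T]_{t,\tau}=T^{-1/2}e^{2\pi j(\tau-1)t/T}$ with $j=\sqrt{-1}$; the angular frequencies are $\omega_\tau=2\pi(\tau-1)/T$, $\tau=1,\dots,T$. The time Laplacian (cycle graph) is $\boldsymbol{L}_T=\boldsymbol{U}_T\,\mathrm{diag}(1-\cos\omega_1,\dots,1-\cos\omega_T)\,\boldsymbol{U}_T^*$. Joint objects. $\boldsymbol{U}_J=\boldsymbol{U}_T\otimes\boldsymbol{U}_G$ (Kronecker product). The joint Laplacian is $\boldsymbol{L}_J=\boldsymbol{L}_T\otimes\boldsymbol{I}_N+\boldsymbol{I}_T\otimes\boldsymbol{L}_G$. For a function $h:\mathbb{R}_+\times\mathbb{R}\to\mathbb{R}$ (the joint frequency response), the joint filter is the matrix $h(\boldsymbol{L}_J)=\boldsymbol{U}_J\,h(\boldsymbol{\Lambda}_G,\boldsymbol{\Omega})\,\boldsymbol{U}_J^*$,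 where $h(\boldsymbol{\Lambda}_G,\boldsymbol{\Omega})$ is the $NT\times NT$ diagonal matrix with $k$-th diagonal entry $h(\lambda_n,\omega_\tau)$ for $k=N(\tau-1)+n$. Joint localization at vertex $i$ and time $t$ is $\mathcal{T}^J_{i,t}h=\mathrm{mat}\big(h(\boldsymbol{L}_J)(\boldsymbol{\delta}_t\otimes\boldsymbol{\delta}_i)\big)\in\mathbb{C}^{N\times T}$, where $\boldsymbol{\delta}$ denotes a Kronecker delta (standard basis vector), $\mathrm{vec}$ stacks the columns of an $N\times T$ matrix, and $\mathrm{mat}$ is the inverse of $\mathrm{vec}$. Processes. A joint time-vertex process is a random $N\times T$ matrix with finite second moments, rows indexed by vertices and columns by time. The input process $\boldsymbol{X}$ is real-valued; the filtered process $\boldsymbol{Y}$ may be complex-valued. For $\boldsymbol{z}=\mathrm{vec}(\boldsymbol{Z})$, $\boldsymbol{\Sigma}_{\boldsymbol{z}}=\mathbb{E}[\boldsymbol{z}\boldsymbol{z}^*]-\mathbb{E}[\boldsymbol{z}]\mathbb{E}[\boldsymbol{z}^*]$. JWSS and JPSD. A process $\boldsymbol{Z}$ with $\boldsymbol{z}=\mathrm{vec}(\boldsymbol{Z})$ is jointly wide-sense stationary (JWSS) if: (1) $\boldsymbol{L}_J\,\mathbb{E}[\boldsymbol{z}]=\boldsymbol{0}_{NT}$; (2) there exists a joint filter $h(\boldsymbol{L}_J)$ such that for all $i\in\{1,\dots,N\}$, $t\in\{1,\dots,T\}$, the $k$-th column of $\boldsymbol{\Sigma}_{\boldsymbol{z}}$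 with $k=N(t-1)+i$ equals $\mathrm{vec}(\mathcal{T}^J_{i,t}h)$; equivalently $\boldsymbol{\Sigma}_{\boldsymbol{z}}=h(\boldsymbol{L}_J)$. Such a function $h$ is called the joint power spectral density (JPSD) of $\boldsymbol{Z}$ (only its values at the pairs $(\lambda_n,\omega_\tau)$ matter). *)

theory Defs
  imports "HOL-Probability.Probability" "Jordan_Normal_Form.Schur_Decomposition"
begin

unbundle no vec_syntax

(* Indices are 0-based throughout: vertices are 0..<N, time steps 0..<T, and the pair of
   vertex i and time t sits at position N * t + i of a vectorised N x T matrix. *)

definition kron_mat :: "'a::semiring_0 mat \<Rightarrow> 'a mat \<Rightarrow> 'a mat" where
  "kron_mat A B = Matrix.mat (dim_row A * dim_row B) (dim_col A * dim_col B)
     (\<lambda>(k, l). A $$ (k div dim_row B, l div dim_col B) * B $$ (k mod dim_row B, l mod dim_col B))"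

definition kron_vec :: "'a::semiring_0 vec \<Rightarrow> 'a vec \<Rightarrow> 'a vec" where
  "kron_vec u v = Matrix.vec (dim_vec u * dim_vec v) (\<lambda>k. u $ (k div dim_vec v) * v $ (k mod dim_vec v))"

definition vec_of_mat :: "'a mat \<Rightarrow> 'a vec" where
  "vec_of_mat Z = Matrix.vec (dim_row Z * dim_col Z) (\<lambda>k. Z $$ (k mod dim_row Z, k div dim_row Z))"

definition mat_of_vec :: "nat \<Rightarrow> nat \<Rightarrow> 'a vec \<Rightarrow> 'a mat" where
  "mat_of_vec N T z = Matrix.mat N T (\<lambda>(i, t). z $ (N * t + i))"

definition unitary_mat :: "nat \<Rightarrow> complex mat \<Rightarrow> bool" where
  "unitary_mat n U \<longleftrightarrow> U \<in> carrier_mat n n \<and> U * mat_adjoint U = 1\<^sub>m n \<and> mat_adjoint U * U = 1\<^sub>m n"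

definition weighted_graph :: "nat \<Rightarrow> real mat \<Rightarrow> bool" where
  "weighted_graph N W \<longleftrightarrow> W \<in> carrier_mat N N \<and>
     (\<forall>i<N. \<forall>j<N. W $$ (i, j) = W $$ (j, i) \<and> 0 \<le> W $$ (i, j))"

definition graph_laplacian :: "nat \<Rightarrow> real mat \<Rightarrow> real mat" where
  "graph_laplacian N W = mat_diag N (\<lambda>i. (W *\<^sub>v Matrix.vec N (\<lambda>_. 1)) $ i) - W"

definition laplacian_eigendecomposition :: "nat \<Rightarrow> real mat \<Rightarrow> complex mat \<Rightarrow> (nat \<Rightarrow> real) \<Rightarrow> bool" where
  "laplacian_eigendecomposition N W UG lam \<longleftrightarrow> unitary_mat N UG \<and>
     map_mat complex_of_real (graph_laplacian N W) =
       UG * mat_diag N (\<lambda>n. complex_of_real (lam n)) * mat_adjoint UG"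

definition ang_freq :: "nat \<Rightarrow> nat \<Rightarrow> real" where
  "ang_freq T \<tau> = 2 * pi * real \<tau> / real T"

(* Row t corresponds to time t + 1 in the 1-based convention, hence the exponent. *)
definition time_fourier :: "nat \<Rightarrow> complex mat" where
  "time_fourier T = Matrix.mat T T
     (\<lambda>(t, \<tau>). exp (\<i> * complex_of_real (ang_freq T \<tau> * real (t + 1))) / complex_of_real (sqrt (real T)))"

definition time_laplacian :: "nat \<Rightarrow> complex mat" where
  "time_laplacian T = time_fourier T *
     mat_diag T (\<lambda>\<tau>. complex_of_real (1 - cos (ang_freq T \<tau>))) * mat_adjoint (time_fourier T)"

definition joint_fourier :: "nat \<Rightarrow> complex mat \<Rightarrow> complex mat" where
  "joint_fourier T UG = kron_mat (time_fourier T) UG"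

definition joint_laplacian :: "nat \<Rightarrow> nat \<Rightarrow> real mat \<Rightarrow> complex mat" where
  "joint_laplacian N T W = kron_mat (time_laplacian T) (1\<^sub>m N) +
     kron_mat (1\<^sub>m T) (map_mat complex_of_real (graph_laplacian N W))"

(* Frequency responses are defined on nonnegative graph frequencies only; they are
   represented by total functions, whose values at negative first arguments are never used. *)
definition joint_filter ::
  "nat \<Rightarrow> nat \<Rightarrow> complex mat \<Rightarrow> (nat \<Rightarrow> real) \<Rightarrow> (real \<Rightarrow> real \<Rightarrow> real) \<Rightarrow> complex mat" where
  "joint_filter N T UG lam h = joint_fourier T UG *
     mat_diag (N * T) (\<lambda>k. complex_of_real (h (lam (k mod N)) (ang_freq T (k div N)))) *
     mat_adjoint (joint_fourier T UG)"

definition joint_localization ::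
  "nat \<Rightarrow> nat \<Rightarrow> complex mat \<Rightarrow> (nat \<Rightarrow> real) \<Rightarrow> nat \<Rightarrow> nat \<Rightarrow> (real \<Rightarrow> real \<Rightarrow> real) \<Rightarrow> complex mat" where
  "joint_localization N T UG lam i t h =
     mat_of_vec N T (joint_filter N T UG lam h *\<^sub>v kron_vec (unit_vec T t) (unit_vec N i))"

definition time_vertex_process :: "'w measure \<Rightarrow> nat \<Rightarrow> nat \<Rightarrow> ('w \<Rightarrow> complex mat) \<Rightarrow> bool" where
  "time_vertex_process M N T Z \<longleftrightarrow>
     (\<forall>\<omega>\<in>space M. Z \<omega> \<in> carrier_mat N T) \<and>
     (\<forall>i<N. \<forall>t<T. (\<lambda>\<omega>. Z \<omega> $$ (i, t)) \<in> borel_measurable M \<and>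
        integrable M (\<lambda>\<omega>. (cmod (Z \<omega> $$ (i, t)))\<^sup>2))"

definition expect_mat :: "'w measure \<Rightarrow> nat \<Rightarrow> nat \<Rightarrow> ('w \<Rightarrow> complex mat) \<Rightarrow> complex mat" where
  "expect_mat M m n Z = Matrix.mat m n (\<lambda>(i, j). LINT \<omega>|M. Z \<omega> $$ (i, j))"

definition expect_vec :: "'w measure \<Rightarrow> nat \<Rightarrow> ('w \<Rightarrow> complex vec) \<Rightarrow> complex vec" where
  "expect_vec M n z = Matrix.vec n (\<lambda>k. LINT \<omega>|M. z \<omega> $ k)"

(* Product of the column u with the row v; no conjugation. *)
definition col_times_row :: "complex vec \<Rightarrow> complex vec \<Rightarrow> complex mat" where
  "col_times_row u v = Matrix.mat (dim_vec u) (dim_vec v) (\<lambda>(k, l). u $ k * v $ l)"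

definition covariance_mat :: "'w measure \<Rightarrow> nat \<Rightarrow> ('w \<Rightarrow> complex vec) \<Rightarrow> complex mat" where
  "covariance_mat M n z = expect_mat M n n (\<lambda>\<omega>. col_times_row (z \<omega>) (conjugate (z \<omega>))) -
     col_times_row (expect_vec M n z) (expect_vec M n (\<lambda>\<omega>. conjugate (z \<omega>)))"

definition is_jpsd ::
  "'w measure \<Rightarrow> nat \<Rightarrow> nat \<Rightarrow> complex mat \<Rightarrow> (nat \<Rightarrow> real) \<Rightarrow> ('w \<Rightarrow> complex mat) \<Rightarrow>
   (real \<Rightarrow> real \<Rightarrow> real) \<Rightarrow> bool" where
  "is_jpsd M N T UG lam Z h \<longleftrightarrow>
     (\<forall>i<N. \<forall>t<T. col (covariance_mat M (N * T) (\<lambda>\<omega>. vec_of_mat (Z \<omega>))) (N * t + i) =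
        vec_of_mat (joint_localization N T UG lam i t h))"

definition jwss ::
  "'w measure \<Rightarrow> nat \<Rightarrow> nat \<Rightarrow> real mat \<Rightarrow> complex mat \<Rightarrow> (nat \<Rightarrow> real) \<Rightarrow>
   ('w \<Rightarrow> complex mat) \<Rightarrow> bool" where
  "jwss M N T W UG lam Z \<longleftrightarrow>
     time_vertex_process M N T Z \<and>
     joint_laplacian N T W *\<^sub>v expect_vec M (N * T) (\<lambda>\<omega>. vec_of_mat (Z \<omega>)) = 0\<^sub>v (N * T) \<and>
     (\<exists>h. is_jpsd M N T UG lam Z h)"

end

theory Submission
  imports Defs
begin

text \<open>
  Joint filters and the joint Laplacian are diagonalized by the same unitary matrix. On the kernel
  of the joint Laplacian, whose eigenvalues are \<open>\<lambda> + (1 - cos \<omega>)\<close> with both summands nonnegative,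
  only the frequency pair \<open>(0, 0)\<close> occurs, so a filter acts there as multiplication by \<open>f(0, 0)\<close>;
  this settles the mean. The covariance transforms as \<open>\<Sigma> \<mapsto> F \<Sigma> F\<^sup>*\<close>, and since \<open>f\<close> is real
  \<open>F\<close> is Hermitian, so that \<open>F h(L) F\<^sup>*\<close> is the filter with response \<open>f\<^sup>2 h\<close>.
\<close>

section \<open>Carriers, diagonal matrices and adjoints\<close>

text \<open>The square case has no free inner dimension, so the simplifier can discharge carrier
  conditions with it.\<close>

lemma mult_square_mat:
  assumes "A \<in> carrier_mat n n" "B \<in> carrier_mat n n"
  shows "A * B \<in> carrier_mat n n"
  using assms by (rule mult_carrier_mat)

lemma index_mat_diag:
  assumes "i < n" "j < n"
  shows "mat_diag n f $$ (i, j) = (if i = j then f i else 0)"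
  using assms by (simp add: mat_diag_def)

lemma mat_adjoint_carrier:
  assumes "A \<in> carrier_mat m n"
  shows "mat_adjoint A \<in> carrier_mat n m"
  using assms by (auto simp: mat_adjoint_def)

lemma index_mat_adjoint:
  assumes "i < dim_col A" "j < dim_row A"
  shows "mat_adjoint A $$ (i, j) = conjugate (A $$ (j, i))"
  using assms by (simp add: mat_adjoint_def mat_of_rows_index)

lemma mat_adjoint_mat_adjoint:
  fixes A :: "'a :: conjugatable_field mat"
  shows "mat_adjoint (mat_adjoint A) = A"
  by (rule eq_matI) (simp_all add: index_mat_adjoint mat_adjoint_def mat_of_rows_index)

lemma mat_adjoint_mult:
  fixes A :: "complex mat"
  assumes "A \<in> carrier_mat m n" "B \<in> carrier_mat n p"
  shows "mat_adjoint (A * B) = mat_adjoint B * mat_adjoint A"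
proof (rule eq_matI)
  note c = mat_adjoint_carrier[OF assms(1)] mat_adjoint_carrier[OF assms(2)]
  show "dim_row (mat_adjoint (A * B)) = dim_row (mat_adjoint B * mat_adjoint A)"
    "dim_col (mat_adjoint (A * B)) = dim_col (mat_adjoint B * mat_adjoint A)"
    using assms by (auto simp: mat_adjoint_def)
  fix i j
  assume "i < dim_row (mat_adjoint B * mat_adjoint A)" "j < dim_col (mat_adjoint B * mat_adjoint A)"
  then have "i < p" "j < m" using c by auto
  then show "mat_adjoint (A * B) $$ (i, j) = (mat_adjoint B * mat_adjoint A) $$ (i, j)"
    using assms c by (auto simp: index_mat_adjoint scalar_prod_def intro!: sum.cong)
qed

text \<open>Conjugation fixes real diagonal entries. This is how real-valuedness of a frequency
  response makes its filter Hermitian.\<close>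

lemma mat_adjoint_mat_diag_of_real:
  "mat_adjoint (mat_diag n (\<lambda>k. complex_of_real (g k))) = mat_diag n (\<lambda>k. complex_of_real (g k))"
  by (rule eq_matI) (auto simp: mat_diag_def mat_adjoint_def mat_of_rows_index)

section \<open>Index pairs encoded as quotient and remainder\<close>

lemma div_less_nat: "k < a * b \<Longrightarrow> k div b < (a :: nat)"
  by (simp add: less_mult_imp_div_less)

lemma mod_less_nat: "k < a * b \<Longrightarrow> k mod b < (b :: nat)"
  by (cases b) auto

lemma mult_add_less_nat:
  assumes "i < m" "j < n"
  shows "i * n + j < m * (n :: nat)"
proof -
  have "i * n + j < Suc i * n" using assms by simp
  also have "\<dots> \<le> m * n" using assms by (intro mult_right_mono) auto
  finally show ?thesis .
qed

text \<open>Division with remainder by \<open>n\<close> is a bijection from the indices below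
  \<open>m * n\<close> onto the pairs. It splits the summation index in a product of Kronecker
  products.\<close>

lemma sum_div_mod:
  fixes g :: "nat \<Rightarrow> nat \<Rightarrow> 'a :: comm_monoid_add"
  shows "(\<Sum>k<m * n. g (k div n) (k mod n)) = (\<Sum>i<m. \<Sum>j<n. g i j)"
proof -
  have "(\<Sum>k<m * n. g (k div n) (k mod n)) = (\<Sum>(i, j)\<in>{..<m} \<times> {..<n}. g i j)"
    by (rule sum.reindex_bij_witness[where i = "\<lambda>(i, j). i * n + j" and j = "\<lambda>k. (k div n, k mod n)"])
      (auto simp: div_less_nat mod_less_nat intro: mult_add_less_nat)
  then show ?thesis
    by (simp add: sum.cartesian_product)
qed

section \<open>Kronecker products\<close>

lemma kron_mat_carrier:
  assumes "A \<in> carrier_mat m n" "B \<in> carrier_mat p q"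
  shows "kron_mat A B \<in> carrier_mat (m * p) (n * q)"
  using assms by (auto simp: kron_mat_def)

lemma index_kron_mat:
  assumes "A \<in> carrier_mat m n" "B \<in> carrier_mat p q" "k < m * p" "l < n * q"
  shows "kron_mat A B $$ (k, l) = A $$ (k div p, l div q) * B $$ (k mod p, l mod q)"
  using assms by (auto simp: kron_mat_def)

text \<open>The mixed-product rule: once the inner index is split into quotient and remainder, the
  double sum factors into an entry of \<open>A * C\<close> times an entry of
  \<open>B * D\<close>.\<close>

lemma kron_mat_mult:
  fixes A :: "'a :: comm_semiring_0 mat"
  assumes "A \<in> carrier_mat m n" "B \<in> carrier_mat p q" "C \<in> carrier_mat n r" "D \<in> carrier_mat q s"
  shows "kron_mat A B * kron_mat C D = kron_mat (A * C) (B * D)"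
proof (rule eq_matI)
  have AB: "kron_mat A B \<in> carrier_mat (m * p) (n * q)" and CD: "kron_mat C D \<in> carrier_mat (n * q) (r * s)"
    and ACBD: "kron_mat (A * C) (B * D) \<in> carrier_mat (m * p) (r * s)"
    using assms by (auto intro!: kron_mat_carrier)
  show "dim_row (kron_mat A B * kron_mat C D) = dim_row (kron_mat (A * C) (B * D))"
    "dim_col (kron_mat A B * kron_mat C D) = dim_col (kron_mat (A * C) (B * D))"
    using AB CD ACBD by auto
  fix k l
  assume "k < dim_row (kron_mat (A * C) (B * D))" "l < dim_col (kron_mat (A * C) (B * D))"
  then have k: "k < m * p" and l: "l < r * s" using ACBD by auto
  note dm = div_less_nat[OF k] mod_less_nat[OF k] div_less_nat[OF l] mod_less_nat[OF l]
  have "(kron_mat A B * kron_mat C D) $$ (k, l) =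
      (\<Sum>x<n * q. kron_mat A B $$ (k, x) * kron_mat C D $$ (x, l))"
    using AB CD k l by (auto simp: scalar_prod_def atLeast0LessThan intro!: sum.cong)
  \<comment> \<open>Commutativity pairs \<open>A\<close> with \<open>C\<close>, which depend on the
    quotient, and \<open>B\<close> with \<open>D\<close>, which depend on the remainder. The
    abstraction over \<open>a\<close> and \<open>b\<close> is the shape that
    \<open>sum_div_mod\<close> rewrites.\<close>
  also have "\<dots> = (\<Sum>x<n * q. (\<lambda>a b. (A $$ (k div p, a) * C $$ (a, l div s)) *
      (B $$ (k mod p, b) * D $$ (b, l mod s))) (x div q) (x mod q))"
    using assms k l by (intro sum.cong) (auto simp: index_kron_mat mult_ac)
  also have "\<dots> = (\<Sum>a<n. A $$ (k div p, a) * C $$ (a, l div s)) *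
      (\<Sum>b<q. B $$ (k mod p, b) * D $$ (b, l mod s))"
    by (subst sum_div_mod) (simp add: sum_product)
  also have "\<dots> = (A * C) $$ (k div p, l div s) * (B * D) $$ (k mod p, l mod s)"
    using assms dm by (auto simp: scalar_prod_def atLeast0LessThan intro!: arg_cong2[where f = "(*)"] sum.cong)
  also have "\<dots> = kron_mat (A * C) (B * D) $$ (k, l)"
    using assms k l by (subst index_kron_mat) auto
  finally show "(kron_mat A B * kron_mat C D) $$ (k, l) = kron_mat (A * C) (B * D) $$ (k, l)" .
qed

lemma mat_adjoint_kron_mat:
  fixes A :: "complex mat"
  assumes "A \<in> carrier_mat m n" "B \<in> carrier_mat p q"
  shows "mat_adjoint (kron_mat A B) = kron_mat (mat_adjoint A) (mat_adjoint B)"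
proof (rule eq_matI)
  note c = mat_adjoint_carrier[OF assms(1)] mat_adjoint_carrier[OF assms(2)]
  note kc = kron_mat_carrier[OF assms] kron_mat_carrier[OF c]
  show "dim_row (mat_adjoint (kron_mat A B)) = dim_row (kron_mat (mat_adjoint A) (mat_adjoint B))"
    "dim_col (mat_adjoint (kron_mat A B)) = dim_col (kron_mat (mat_adjoint A) (mat_adjoint B))"
    using kc mat_adjoint_carrier[OF kc(1)] by auto
  fix k l
  assume "k < dim_row (kron_mat (mat_adjoint A) (mat_adjoint B))"
    "l < dim_col (kron_mat (mat_adjoint A) (mat_adjoint B))"
  then have k: "k < n * q" and l: "l < m * p" using kc by auto
  note dm = div_less_nat[OF k] mod_less_nat[OF k] div_less_nat[OF l] mod_less_nat[OF l]
  have "mat_adjoint (kron_mat A B) $$ (k, l) = cnj (A $$ (l div p, k div q) * B $$ (l mod p, k mod q))"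
    using kc assms k l by (simp add: index_mat_adjoint index_kron_mat[OF assms])
  also have "\<dots> = kron_mat (mat_adjoint A) (mat_adjoint B) $$ (k, l)"
    using assms dm by (simp add: index_kron_mat[OF c k l] index_mat_adjoint)
  finally show "mat_adjoint (kron_mat A B) $$ (k, l) = kron_mat (mat_adjoint A) (mat_adjoint B) $$ (k, l)" .
qed

text \<open>An index is determined by its quotient and remainder, so both factors are on their
  diagonals exactly when the product is. Constant entries \<open>1\<close> cover identity
  matrices.\<close>

lemma kron_mat_mat_diag:
  fixes g h :: "nat \<Rightarrow> 'a :: semiring_0"
  shows "kron_mat (mat_diag m g) (mat_diag n h) = mat_diag (m * n) (\<lambda>k. g (k div n) * h (k mod n))"
proof (rule eq_matI)
  fix i j
  assume "i < dim_row (mat_diag (m * n) (\<lambda>k. g (k div n) * h (k mod n)))"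
    "j < dim_col (mat_diag (m * n) (\<lambda>k. g (k div n) * h (k mod n)))"
  then have i: "i < m * n" and j: "j < m * n" by (auto simp: mat_diag_def)
  note dm = div_less_nat[OF i] mod_less_nat[OF i] div_less_nat[OF j] mod_less_nat[OF j]
  have "i = j" if "i div n = j div n" "i mod n = j mod n"
    using that by (metis div_mult_mod_eq)
  then show "kron_mat (mat_diag m g) (mat_diag n h) $$ (i, j) =
      mat_diag (m * n) (\<lambda>k. g (k div n) * h (k mod n)) $$ (i, j)"
    using i j dm by (auto simp: index_kron_mat[OF mat_diag_dim mat_diag_dim i j] index_mat_diag)
qed (auto simp: kron_mat_def mat_diag_def)

text \<open>The adjoint distributes over the two factors, and the mixed-product rule then reduces
  both unitarity equations to those of \<open>U\<close> and \<open>V\<close>.\<close>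

lemma unitary_kron_mat:
  assumes "unitary_mat m U" "unitary_mat n V"
  shows "unitary_mat (m * n) (kron_mat U V)"
proof -
  have U: "U \<in> carrier_mat m m" "U * mat_adjoint U = 1\<^sub>m m" "mat_adjoint U * U = 1\<^sub>m m"
    and V: "V \<in> carrier_mat n n" "V * mat_adjoint V = 1\<^sub>m n" "mat_adjoint V * V = 1\<^sub>m n"
    using assms by (auto simp: unitary_mat_def)
  note c = mat_adjoint_carrier[OF U(1)] mat_adjoint_carrier[OF V(1)]
  have one: "kron_mat (1\<^sub>m m) (1\<^sub>m n) = (1\<^sub>m (m * n) :: complex mat)"
    using kron_mat_mat_diag[of m "\<lambda>_. 1 :: complex" n "\<lambda>_. 1"] by simp
  show ?thesis
    using kron_mat_carrier[OF U(1) V(1)] kron_mat_mult[OF U(1) V(1) c] kron_mat_mult[OF c U(1) V(1)]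
    by (simp add: unitary_mat_def mat_adjoint_kron_mat[OF U(1) V(1)] U V one)
qed

section \<open>Unitarity of the discrete Fourier basis\<close>

text \<open>A geometric sum whose ratio \<open>z\<close> satisfies \<open>z ^ T = 1\<close> but
  \<open>z \<noteq> 1\<close>.\<close>

lemma sum_exp_root_unity:
  fixes d :: int
  assumes "\<not> int T dvd d" "T > 0"
  shows "(\<Sum>t<T. exp (2 * of_real pi * \<i> * of_int d / of_nat T) ^ t) = 0"
proof -
  define z where "z = exp (2 * of_real pi * \<i> * of_int d / of_nat T)"
  have "z ^ T = exp (of_nat T * (2 * of_real pi * \<i> * of_int d / of_nat T))"
    by (simp only: z_def exp_of_nat_mult)
  also have "\<dots> = exp (2 * of_int d * of_real pi * \<i>)"
    using assms(2) by (simp add: mult_ac)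
  also have "\<dots> = 1" by (subst exp_eq_1) (auto intro!: exI[of _ d])
  finally have zT: "z ^ T = 1" .
  \<comment> \<open>If \<open>z = 1\<close>, the angle \<open>2 * pi * d / T\<close> is a multiple
    of \<open>2 * pi\<close>, so \<open>T\<close> divides \<open>d\<close>.\<close>
  have "z \<noteq> 1"
  proof
    assume "z = 1"
    then obtain k :: int where "2 * pi * of_int d / of_nat T = of_int (2 * k) * pi"
      by (auto simp: z_def exp_eq_1)
    then have "(of_int d :: real) = of_int (k * int T)"
      using assms(2) by (simp add: field_simps)
    then have "d = k * int T" by (simp only: of_int_eq_iff)
    then show False using assms(1) by simp
  qed
  then show ?thesis
    using zT by (simp add: z_def[symmetric] sum_gp_strict)
qed

text \<open>The phases subtract and the two factors \<open>1 / sqrt T\<close> combine. The remaining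
  phase is an integer multiple of \<open>2 * pi / T\<close>, which brings the entries into the form
  of root-of-unity sums. The shifts by one come from row \<open>t\<close> standing for time
  \<open>t + 1\<close>.\<close>

lemma index_time_fourier_mult_adjoint:
  assumes "T > 0" "a < T" "b < T" "c < T" "d < T"
  shows "time_fourier T $$ (a, b) * cnj (time_fourier T $$ (c, d)) =
    exp (2 * of_real pi * \<i> * of_int (int b * (int a + 1) - int d * (int c + 1)) / of_nat T) / of_nat T"
proof -
  have s: "complex_of_real (sqrt (real T)) * complex_of_real (sqrt (real T)) = of_nat T"
    by (simp flip: of_real_mult)
  have "time_fourier T $$ (a, b) * cnj (time_fourier T $$ (c, d)) =
     exp (\<i> * complex_of_real (ang_freq T b * real (a + 1))) *
     exp (- (\<i> * complex_of_real (ang_freq T d * real (c + 1)))) / of_nat T"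
    using assms s by (simp add: time_fourier_def exp_cnj)
  also have "exp (\<i> * complex_of_real (ang_freq T b * real (a + 1))) *
     exp (- (\<i> * complex_of_real (ang_freq T d * real (c + 1)))) =
     exp (2 * of_real pi * \<i> * of_int (int b * (int a + 1) - int d * (int c + 1)) / of_nat T)"
    using assms(1) by (auto simp: ang_freq_def field_simps simp flip: exp_add intro!: arg_cong[where f = exp])
  finally show ?thesis .
qed

lemma unitary_time_fourier:
  assumes "T > 0"
  shows "unitary_mat T (time_fourier T)"
proof -
  let ?F = "time_fourier T"
  let ?e = "\<lambda>d. exp (2 * of_real pi * \<i> * of_int d / of_nat T)"
  have F: "?F \<in> carrier_mat T T" by (simp add: time_fourier_def)
  note F' = mat_adjoint_carrier[OF F]
  \<comment> \<open>The difference is nonzero and smaller than \<open>T\<close> in absolute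
    value.\<close>
  have ndvd: "\<not> int T dvd int a - int b" if "a < T" "b < T" "a \<noteq> b" for a b
    using that by (smt (verit) zdvd_not_zless of_nat_less_iff of_nat_0_le_iff dvd_diff_commute of_nat_eq_iff)
  have e_add: "?e (x + y) = ?e x * ?e y" for x y
    by (simp add: field_simps add_divide_distrib flip: exp_add)
  have e_mult: "?e (int k * x) = ?e x ^ k" for k x
    by (simp add: mult_ac flip: exp_of_nat_mult)
  \<comment> \<open>Row orthogonality: here the shift of the time index cancels and a pure geometric
    sum is left.\<close>
  have one: "(?F * mat_adjoint ?F) $$ (a, b) = (1\<^sub>m T) $$ (a, b)" if "a < T" "b < T" for a b
  proof -
    have "(?F * mat_adjoint ?F) $$ (a, b) = (\<Sum>k<T. ?F $$ (a, k) * cnj (?F $$ (b, k)))"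
      using F F' that by (auto simp: scalar_prod_def index_mat_adjoint atLeast0LessThan intro!: sum.cong)
    also have "\<dots> = (\<Sum>k<T. ?e (int k * (int a - int b)) / of_nat T)"
      using assms that by (intro sum.cong) (auto simp: index_time_fourier_mult_adjoint algebra_simps)
    also have "\<dots> = (\<Sum>k<T. ?e (int a - int b) ^ k) / of_nat T"
      by (simp only: e_mult sum_divide_distrib)
    also have "\<dots> = (1\<^sub>m T) $$ (a, b)"
      using that assms sum_exp_root_unity[OF ndvd assms, of a b] by (cases "a = b") simp_all
    finally show ?thesis .
  qed
  \<comment> \<open>Column orthogonality: the summation index is now the time, so its shift leaves
    the constant phase \<open>?e (int b - int a)\<close> in front of the geometric sum.\<close>
  have two: "(mat_adjoint ?F * ?F) $$ (a, b) = (1\<^sub>m T) $$ (a, b)" if "a < T" "b < T" for a b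
  proof -
    have "(mat_adjoint ?F * ?F) $$ (a, b) = (\<Sum>k<T. ?F $$ (k, b) * cnj (?F $$ (k, a)))"
      using F F' that by (auto simp: scalar_prod_def index_mat_adjoint atLeast0LessThan intro!: sum.cong)
    also have "\<dots> = (\<Sum>k<T. ?e (int b - int a) * ?e (int k * (int b - int a)) / of_nat T)"
      using assms that unfolding e_add[symmetric]
      by (intro sum.cong) (auto simp: index_time_fourier_mult_adjoint algebra_simps)
    also have "\<dots> = ?e (int b - int a) * (\<Sum>k<T. ?e (int b - int a) ^ k) / of_nat T"
      by (simp only: e_mult sum_divide_distrib sum_distrib_left)
    also have "\<dots> = (1\<^sub>m T) $$ (a, b)"
      using that assms sum_exp_root_unity[OF ndvd assms, of b a] by (cases "a = b") simp_all
    finally show ?thesis .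
  qed
  show ?thesis
    unfolding unitary_mat_def using F F' one two by (auto intro!: eq_matI)
qed


section \<open>Unitarily diagonalized matrices and the sign of the graph spectrum\<close>

text \<open>The inner factor \<open>mat_adjoint U * U\<close> cancels, so the diagonals multiply
  pointwise.\<close>

lemma unitary_mult_mat_diag_mult:
  assumes "unitary_mat n U"
  shows "(U * mat_diag n g * mat_adjoint U) * (U * mat_diag n h * mat_adjoint U) =
    U * mat_diag n (\<lambda>k. g k * h k) * mat_adjoint U"
proof -
  have U: "U \<in> carrier_mat n n" "mat_adjoint U * U = 1\<^sub>m n"
    using assms by (auto simp: unitary_mat_def)
  note U' = mat_adjoint_carrier[OF U(1)]
  let ?G = "mat_diag n g" and ?H = "mat_diag n h"
  have "(U * ?G * mat_adjoint U) * (U * ?H * mat_adjoint U) =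
      U * (?G * ((mat_adjoint U * U) * (?H * mat_adjoint U)))"
    using U(1) U' by (simp add: mult_square_mat assoc_mult_mat[where ?n\<^sub>1 = n and ?n\<^sub>2 = n and ?n\<^sub>3 = n and ?n\<^sub>4 = n])
  also have "\<dots> = U * (?G * (?H * mat_adjoint U))"
    using U' by (simp add: U(2) left_mult_one_mat[of _ n n] mult_square_mat)
  also have "\<dots> = U * (?G * ?H * mat_adjoint U)"
    using U' by (simp only: assoc_mult_mat[OF mat_diag_dim mat_diag_dim U'])
  also have "\<dots> = U * mat_diag n (\<lambda>k. g k * h k) * mat_adjoint U"
    using assoc_mult_mat[OF U(1) mat_diag_dim U'] by simp
  finally show ?thesis .
qed

lemma mat_adjoint_mult_mat_diag_mult:
  assumes "U \<in> carrier_mat n n"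
  shows "mat_adjoint (U * mat_diag n (\<lambda>k. complex_of_real (g k)) * mat_adjoint U) =
    U * mat_diag n (\<lambda>k. complex_of_real (g k)) * mat_adjoint U"
proof -
  note U' = mat_adjoint_carrier[OF assms]
  show ?thesis
    using assms U'
    by (simp add: mat_adjoint_mult[where m = n and n = n and p = n] mat_adjoint_mat_adjoint
        mat_adjoint_mat_diag_of_real mult_square_mat assoc_mult_mat[where ?n\<^sub>1 = n and ?n\<^sub>2 = n and ?n\<^sub>3 = n and ?n\<^sub>4 = n])
qed

text \<open>Evaluate the eigenvector equation at an entry of maximal modulus, as for Gershgorin discs:
  this gives \<open>\<bar>\<lambda> - d\<bar> \<le> d\<close> for the degree \<open>d\<close> of that vertex.\<close>

lemma graph_laplacian_eigenvalue_nonneg: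
  assumes W: "weighted_graph N W"
    and eig: "laplacian_eigendecomposition N W UG lam"
    and n: "n < N"
  shows "0 \<le> lam n"
proof -
  have U: "UG \<in> carrier_mat N N" "mat_adjoint UG * UG = 1\<^sub>m N"
    and L: "map_mat complex_of_real (graph_laplacian N W) =
       UG * mat_diag N (\<lambda>n. complex_of_real (lam n)) * mat_adjoint UG"
    using eig by (auto simp: laplacian_eigendecomposition_def unitary_mat_def)
  note U' = mat_adjoint_carrier[OF U(1)]
  have Wc: "W \<in> carrier_mat N N" and W0: "\<And>i j. i < N \<Longrightarrow> j < N \<Longrightarrow> 0 \<le> W $$ (i, j)"
    using W by (auto simp: weighted_graph_def)
  let ?L = "map_mat complex_of_real (graph_laplacian N W)"
  let ?D = "mat_diag N (\<lambda>n. complex_of_real (lam n))"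
  have Lc: "?L \<in> carrier_mat N N" using Wc by (auto simp: graph_laplacian_def mat_diag_def)
  \<comment> \<open>Multiplying the decomposition by \<open>UG\<close> from the right shows that the
    columns of \<open>UG\<close> are eigenvectors.\<close>
  have LU: "?L * UG = UG * ?D"
    using U U' by (simp add: L right_mult_one_mat[OF mat_diag_dim] mult_square_mat assoc_mult_mat[where ?n\<^sub>1 = N and ?n\<^sub>2 = N and ?n\<^sub>3 = N and ?n\<^sub>4 = N])
  \<comment> \<open>\<open>u\<close> is the eigenvector for \<open>lam n\<close>, and
    \<open>d\<close> is the degree, which counts a possible loop weight as well.\<close>
  define u where "u i = UG $$ (i, n)" for i
  define d where "d i = (\<Sum>j<N. W $$ (i, j))" for i
  have Lij: "graph_laplacian N W $$ (i, j) = (if i = j then d i else 0) - W $$ (i, j)"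
    if "i < N" "j < N" for i j
    using Wc that by (auto simp: graph_laplacian_def mat_diag_def d_def scalar_prod_def atLeast0LessThan)
  have eigen: "complex_of_real (lam n) * u i = d i * u i - (\<Sum>j<N. W $$ (i, j) * u j)" if i: "i < N" for i
  proof -
    have "complex_of_real (lam n) * u i = (UG * ?D) $$ (i, n)"
      using U(1) i n by (simp add: mat_diag_mult_right[OF U(1)] u_def)
    also have "\<dots> = (\<Sum>j<N. complex_of_real (graph_laplacian N W $$ (i, j)) * u j)"
      using U(1) Lc i n
      by (auto simp flip: LU simp: scalar_prod_def u_def atLeast0LessThan intro!: sum.cong)
    also have "\<dots> = (\<Sum>j<N. (if i = j then d i * u j else 0) - W $$ (i, j) * u j)"
      using i by (intro sum.cong) (auto simp: Lij algebra_simps)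
    also have "\<dots> = d i * u i - (\<Sum>j<N. W $$ (i, j) * u j)"
      using i by (simp add: sum_subtractf)
    finally show ?thesis .
  qed
  obtain i where i: "i < N" and max: "\<And>j. j < N \<Longrightarrow> cmod (u j) \<le> cmod (u i)"
  proof -
    have "Max ((\<lambda>j. cmod (u j)) ` {..<N}) \<in> (\<lambda>j. cmod (u j)) ` {..<N}"
      using n by (intro Max_in) auto
    then obtain i where "i < N" "cmod (u i) = Max ((\<lambda>j. cmod (u j)) ` {..<N})" by auto
    then show ?thesis by (intro that[of i]) auto
  qed
  \<comment> \<open>If the largest entry vanished, so would column \<open>n\<close> of
    \<open>UG\<close>, against the diagonal entry \<open>1\<close> of
    \<open>mat_adjoint UG * UG\<close>.\<close>
  have "u i \<noteq> 0"
  proof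
    assume "u i = 0"
    then have "\<And>j. j < N \<Longrightarrow> UG $$ (j, n) = 0" using max by (auto simp: u_def)
    then have "(mat_adjoint UG * UG) $$ (n, n) = 0"
      using U(1) U' n by (auto simp: scalar_prod_def intro!: sum.neutral)
    then show False using U(2) n by simp
  qed
  have "\<bar>d i - lam n\<bar> * cmod (u i) = cmod (d i * u i - lam n * u i)"
    by (simp add: norm_mult flip: left_diff_distrib of_real_diff)
  also have "\<dots> = cmod (\<Sum>j<N. W $$ (i, j) * u j)"
    by (simp add: eigen[OF i])
  also have "\<dots> \<le> (\<Sum>j<N. W $$ (i, j) * cmod (u i))"
    using W0 i by (intro sum_norm_le) (auto simp: norm_mult intro!: mult_left_mono max)
  also have "\<dots> = d i * cmod (u i)" by (simp add: d_def sum_distrib_right)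
  finally have "\<bar>d i - lam n\<bar> \<le> d i" using \<open>u i \<noteq> 0\<close> by simp
  then show ?thesis by simp
qed

section \<open>The joint Laplacian and its kernel\<close>

lemma unitary_joint_fourier:
  assumes "T \<ge> 1" "unitary_mat N UG"
  shows "unitary_mat (N * T) (joint_fourier T UG)"
  using unitary_kron_mat[OF unitary_time_fourier assms(2), of T] assms(1)
  by (simp add: joint_fourier_def mult.commute)

text \<open>In each summand the identity factor is written as a unitary times its adjoint. The
  mixed-product rule then pulls the same joint basis out of both summands, and the diagonals
  add.\<close>

lemma joint_laplacian_diagonalization:
  assumes T: "T \<ge> 1" and eig: "laplacian_eigendecomposition N W UG lam"
  shows "joint_laplacian N T W = joint_fourier T UG *
    mat_diag (N * T) (\<lambda>k. complex_of_real (1 - cos (ang_freq T (k div N)) + lam (k mod N))) *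
    mat_adjoint (joint_fourier T UG)"
proof -
  let ?F = "time_fourier T" and ?U = "joint_fourier T UG"
  let ?C = "mat_diag T (\<lambda>\<tau>. complex_of_real (1 - cos (ang_freq T \<tau>)))"
  let ?D = "mat_diag N (\<lambda>n. complex_of_real (lam n))"
  let ?c = "\<lambda>k. complex_of_real (1 - cos (ang_freq T (k div N)))"
  let ?d = "\<lambda>k. complex_of_real (lam (k mod N))"
  have F: "?F \<in> carrier_mat T T" "?F * mat_adjoint ?F = 1\<^sub>m T"
    using unitary_time_fourier[of T] T by (auto simp: unitary_mat_def)
  have G: "UG \<in> carrier_mat N N" "UG * mat_adjoint UG = 1\<^sub>m N"
    and L: "map_mat complex_of_real (graph_laplacian N W) = UG * ?D * mat_adjoint UG"
    using eig by (auto simp: laplacian_eigendecomposition_def unitary_mat_def)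
  note F' = mat_adjoint_carrier[OF F(1)] and G' = mat_adjoint_carrier[OF G(1)]
  have U: "?U \<in> carrier_mat (N * T) (N * T)"
    using kron_mat_carrier[OF F(1) G(1)] by (simp add: joint_fourier_def mult.commute)
  note U' = mat_adjoint_carrier[OF U]
  have kron: "kron_mat (?F * P * mat_adjoint ?F) (UG * Q * mat_adjoint UG) =
      ?U * kron_mat P Q * mat_adjoint ?U" if "P \<in> carrier_mat T T" "Q \<in> carrier_mat N N" for P Q
    using F(1) F' G(1) G' that
    by (simp add: joint_fourier_def mat_adjoint_kron_mat[OF F(1) G(1)]
        kron_mat_mult[where m = T and n = T and r = T and p = N and q = N and s = N])
  have one: "kron_mat ?C (1\<^sub>m N) = mat_diag (N * T) ?c" "kron_mat (1\<^sub>m T) ?D = mat_diag (N * T) ?d"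
    using kron_mat_mat_diag[of T "\<lambda>\<tau>. complex_of_real (1 - cos (ang_freq T \<tau>))" N "\<lambda>_. 1"]
      kron_mat_mat_diag[of T "\<lambda>_. 1" N "\<lambda>n. complex_of_real (lam n)"]
    by (simp_all add: mult.commute)
  have "kron_mat (time_laplacian T) (1\<^sub>m N) = ?U * mat_diag (N * T) ?c * mat_adjoint ?U"
    using kron[of ?C "1\<^sub>m N"] G one by (simp add: time_laplacian_def)
  moreover have "kron_mat (1\<^sub>m T) (map_mat complex_of_real (graph_laplacian N W)) =
      ?U * mat_diag (N * T) ?d * mat_adjoint ?U"
    using kron[of "1\<^sub>m T" ?D] F one by (simp add: L)
  moreover have "?U * mat_diag (N * T) ?c * mat_adjoint ?U + ?U * mat_diag (N * T) ?d * mat_adjoint ?U =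
      ?U * (mat_diag (N * T) ?c + mat_diag (N * T) ?d) * mat_adjoint ?U"
    using U U'
    by (simp add: add_mult_distrib_mat[where nr = "N * T" and n = "N * T"]
        mult_add_distrib_mat[where nr = "N * T" and n = "N * T" and nc = "N * T"])
  moreover have "mat_diag (N * T) ?c + mat_diag (N * T) ?d = mat_diag (N * T) (\<lambda>k. ?c k + ?d k)"
    by (rule eq_matI) (auto simp: mat_diag_def)
  ultimately show ?thesis by (simp add: joint_laplacian_def)
qed

text \<open>A cosine equal to 1 makes the angle a multiple of \<open>2 * pi\<close>, so
  \<open>T\<close> divides \<open>\<tau>\<close>; below \<open>T\<close> this leaves only 0.\<close>

lemma ang_freq_eq_0:
  assumes "\<tau> < T" "cos (ang_freq T \<tau>) = 1"
  shows "\<tau> = 0"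
proof -
  obtain n :: int where "2 * pi * real \<tau> / real T = of_int n * 2 * pi"
    using assms(2) by (auto simp: ang_freq_def cos_one_2pi_int)
  then have "real \<tau> = of_int n * real T" using assms(1) by (simp add: field_simps)
  then have "int \<tau> = n * int T" by (metis of_int_eq_iff of_int_mult of_int_of_nat_eq)
  then show ?thesis
    using assms(1) by (metis dvd_imp_le dvd_triv_right int_dvd_int_iff linorder_not_le not_gr_zero)
qed

text \<open>Expand \<open>m\<close> in the joint Fourier basis with coefficients \<open>c\<close>.
  Each coefficient is annihilated by its eigenvalue of the joint Laplacian, so the nonzero ones sit
  at frequency pair \<open>(0, 0)\<close>, where the filter multiplies by
  \<open>f 0 0\<close>.\<close>

lemma joint_filter_kernel_joint_laplacian:
  assumes T: "T \<ge> 1" and W: "weighted_graph N W" and eig: "laplacian_eigendecomposition N W UG lam"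
    and m: "m \<in> carrier_vec (N * T)" and ker: "joint_laplacian N T W *\<^sub>v m = 0\<^sub>v (N * T)"
  shows "joint_filter N T UG lam f *\<^sub>v m = complex_of_real (f 0 0) \<cdot>\<^sub>v m"
proof -
  let ?n = "N * T"
  define U where "U = joint_fourier T UG"
  have "unitary_mat N UG" using eig by (simp add: laplacian_eigendecomposition_def)
  from unitary_joint_fourier[OF T this]
  have U: "U \<in> carrier_mat ?n ?n" "U * mat_adjoint U = 1\<^sub>m ?n" "mat_adjoint U * U = 1\<^sub>m ?n"
    by (auto simp: unitary_mat_def U_def)
  note U' = mat_adjoint_carrier[OF U(1)]
  define c where "c = mat_adjoint U *\<^sub>v m"
  have c: "c \<in> carrier_vec ?n" using U' m by (simp add: c_def)
  have Uc: "U *\<^sub>v c = m"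
    using U(2) m assoc_mult_mat_vec[OF U(1) U' m] by (simp add: c_def)
  have spec: "(U * mat_diag ?n g * mat_adjoint U) *\<^sub>v m = U *\<^sub>v (mat_diag ?n g *\<^sub>v c)" for g
    using U(1) U' m
    by (simp add: c_def assoc_mult_mat_vec[where ?n\<^sub>1 = ?n and ?n\<^sub>2 = ?n and ?n\<^sub>3 = ?n])
  have diag: "mat_diag ?n g *\<^sub>v c = Matrix.vec ?n (\<lambda>k. g k * c $ k)" for g
    using c by (intro eq_vecI) (auto simp: mat_diag_def scalar_prod_def if_distrib[of "\<lambda>x. x * _"] cong: if_cong)
  let ?e = "\<lambda>k. complex_of_real (1 - cos (ang_freq T (k div N)) + lam (k mod N))"
  \<comment> \<open>Unitarity strips \<open>U\<close> from the kernel equation, which turns it into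
    one scalar equation per frequency.\<close>
  have "mat_diag ?n ?e *\<^sub>v c = mat_adjoint U *\<^sub>v (U *\<^sub>v (mat_diag ?n ?e *\<^sub>v c))"
    using U(3) c assoc_mult_mat_vec[OF U' U(1), of "mat_diag ?n ?e *\<^sub>v c"] by (simp add: diag)
  also have "\<dots> = 0\<^sub>v ?n"
  proof -
    have "U *\<^sub>v (mat_diag ?n ?e *\<^sub>v c) = 0\<^sub>v ?n"
      unfolding spec[symmetric] unfolding U_def using ker by (simp only: joint_laplacian_diagonalization[OF T eig])
    then show ?thesis using U' by (auto simp: scalar_prod_def intro!: eq_vecI)
  qed
  finally have "Matrix.vec ?n (\<lambda>k. ?e k * c $ k) = 0\<^sub>v ?n" unfolding diag .
  then have zero: "?e k * c $ k = 0" if "k < ?n" for k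
    using that by (auto dest: arg_cong[of _ _ "\<lambda>v. v $ k"])
  have "complex_of_real (f (lam (k mod N)) (ang_freq T (k div N))) * c $ k =
      complex_of_real (f 0 0) * c $ k" if k: "k < ?n" for k
  proof (cases "c $ k = 0")
    case False
    from k have "k mod N < N" and kT: "k div N < T"
      using mod_less_nat[of k T N] div_less_nat[of k T N] by (auto simp: mult.commute)
    then have "0 \<le> lam (k mod N)" using graph_laplacian_eigenvalue_nonneg[OF W eig] by simp
    moreover have "1 - cos (ang_freq T (k div N)) + lam (k mod N) = 0"
      using zero[OF k] False by (simp only: mult_eq_0_iff of_real_eq_0_iff) simp
    ultimately have "lam (k mod N) = 0" and "cos (ang_freq T (k div N)) = 1"
      \<comment> \<open>Two nonnegative numbers with sum zero both vanish.\<close>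
      using cos_le_one[of "ang_freq T (k div N)"] by linarith+
    then show ?thesis using ang_freq_eq_0[OF kT] by (simp add: ang_freq_def)
  qed simp
  then have "mat_diag ?n (\<lambda>k. complex_of_real (f (lam (k mod N)) (ang_freq T (k div N)))) *\<^sub>v c =
      complex_of_real (f 0 0) \<cdot>\<^sub>v c"
    using c by (intro eq_vecI) (auto simp: diag)
  then show ?thesis
    using U(1) c Uc by (simp add: joint_filter_def spec mult_mat_vec[OF U(1) c] flip: U_def)
qed


section \<open>Second moments under linear maps\<close>

text \<open>The modulus of the product is dominated by the sum of the two squared moduli.\<close>

lemma square_integrable_mult_cnj:
  fixes u v :: "'w \<Rightarrow> complex"
  assumes "u \<in> borel_measurable M" "integrable M (\<lambda>\<omega>. (cmod (u \<omega>))\<^sup>2)"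
    and "v \<in> borel_measurable M" "integrable M (\<lambda>\<omega>. (cmod (v \<omega>))\<^sup>2)"
  shows "integrable M (\<lambda>\<omega>. u \<omega> * cnj (v \<omega>))"
proof (rule Bochner_Integration.integrable_bound)
  show "integrable M (\<lambda>\<omega>. (cmod (u \<omega>))\<^sup>2 + (cmod (v \<omega>))\<^sup>2)"
    using assms by simp
  show "(\<lambda>\<omega>. u \<omega> * cnj (v \<omega>)) \<in> borel_measurable M"
    using assms(1) borel_measurable_continuous_on[OF continuous_on_cnj[OF continuous_on_id] assms(3)]
    by (rule borel_measurable_times)
  have "x * y \<le> x\<^sup>2 + y\<^sup>2" if "0 \<le> x" "0 \<le> y" for x y :: real
    using sum_squares_bound[of x y] mult_nonneg_nonneg[OF that] by linarith
  then show "AE \<omega> in M. norm (u \<omega> * cnj (v \<omega>)) \<le> norm ((cmod (u \<omega>))\<^sup>2 + (cmod (v \<omega>))\<^sup>2)"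
    by (auto simp: norm_mult)
qed

text \<open>Pairing with the constant 1 suffices, as it is square integrable under a probability
  measure.\<close>

lemma (in prob_space) square_integrable_imp_integrable_complex:
  fixes u :: "'a \<Rightarrow> complex"
  assumes "u \<in> borel_measurable M" "integrable M (\<lambda>\<omega>. (cmod (u \<omega>))\<^sup>2)"
  shows "integrable M u"
  using square_integrable_mult_cnj[OF assms, of "\<lambda>_. 1"] by simp

text \<open>The squared modulus expands into a finite double sum of products
  \<open>u a * cnj (u b)\<close>, each of them integrable. The expansion is complex-valued, so
  integrability is carried back to the reals at the end.\<close>

lemma square_integrable_sum:
  fixes u :: "nat \<Rightarrow> 'w \<Rightarrow> complex"
  assumes "\<And>a. a < n \<Longrightarrow> u a \<in> borel_measurable M"
    and "\<And>a. a < n \<Longrightarrow> integrable M (\<lambda>\<omega>. (cmod (u a \<omega>))\<^sup>2)"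
  shows "integrable M (\<lambda>\<omega>. (cmod (\<Sum>a<n. c a * u a \<omega>))\<^sup>2)"
proof -
  have "integrable M (\<lambda>\<omega>. \<Sum>a<n. \<Sum>b<n. c a * cnj (c b) * (u a \<omega> * cnj (u b \<omega>)))"
    using assms by (intro Bochner_Integration.integrable_sum integrable_mult_right square_integrable_mult_cnj) auto
  then have "integrable M (\<lambda>\<omega>. complex_of_real ((cmod (\<Sum>a<n. c a * u a \<omega>))\<^sup>2))"
    by (simp only: complex_norm_square cnj_sum sum_product complex_cnj_mult mult_ac)
  then show ?thesis by (simp only: complex_of_real_integrable_eq)
qed

text \<open>Covariance is sesquilinear. The second mean stays the integral of a conjugate, the form
  that \<open>covariance_mat\<close> uses.\<close>

lemma (in prob_space) covariance_sum:
  fixes x :: "nat \<Rightarrow> 'a \<Rightarrow> complex"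
  assumes "\<And>a. a < n \<Longrightarrow> x a \<in> borel_measurable M"
    and "\<And>a. a < n \<Longrightarrow> integrable M (\<lambda>\<omega>. (cmod (x a \<omega>))\<^sup>2)"
  shows "(LINT \<omega>|M. (\<Sum>a<n. c a * x a \<omega>) * cnj (\<Sum>b<n. d b * x b \<omega>)) -
      (LINT \<omega>|M. (\<Sum>a<n. c a * x a \<omega>)) * (LINT \<omega>|M. cnj (\<Sum>b<n. d b * x b \<omega>)) =
    (\<Sum>a<n. \<Sum>b<n. c a * cnj (d b) *
      ((LINT \<omega>|M. x a \<omega> * cnj (x b \<omega>)) - (LINT \<omega>|M. x a \<omega>) * (LINT \<omega>|M. cnj (x b \<omega>))))"
proof -
  have int: "integrable M (x a)" if "a < n" for a
    using assms that by (intro square_integrable_imp_integrable_complex)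
  have int2: "integrable M (\<lambda>\<omega>. x a \<omega> * cnj (x b \<omega>))" if "a < n" "b < n" for a b
    using assms that by (intro square_integrable_mult_cnj)
  have "(LINT \<omega>|M. (\<Sum>a<n. c a * x a \<omega>) * cnj (\<Sum>b<n. d b * x b \<omega>)) =
      (LINT \<omega>|M. (\<Sum>a<n. \<Sum>b<n. c a * cnj (d b) * (x a \<omega> * cnj (x b \<omega>))))"
    by (simp only: cnj_sum sum_product complex_cnj_mult mult_ac)
  also have "\<dots> = (\<Sum>a<n. \<Sum>b<n. c a * cnj (d b) * (LINT \<omega>|M. x a \<omega> * cnj (x b \<omega>)))"
    by (subst Bochner_Integration.integral_sum;
        intro Bochner_Integration.integrable_sum integrable_mult_right int2 sum.cong refl)
      (auto simp: int2 intro!: trans[OF Bochner_Integration.integral_sum])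
  moreover have "(LINT \<omega>|M. (\<Sum>a<n. c a * x a \<omega>)) = (\<Sum>a<n. c a * (LINT \<omega>|M. x a \<omega>))"
    using int by (simp add: Bochner_Integration.integral_sum)
  moreover have "(LINT \<omega>|M. cnj (\<Sum>b<n. d b * x b \<omega>)) = (\<Sum>b<n. cnj (d b) * (LINT \<omega>|M. cnj (x b \<omega>)))"
    using int by (simp add: Bochner_Integration.integral_sum)
  ultimately show ?thesis
    by (simp add: sum_product right_diff_distrib mult_ac flip: sum_subtractf)
qed

lemma index_mult_mat_vec_sum:
  assumes "A \<in> carrier_mat m n" "v \<in> carrier_vec n" "k < m"
  shows "(A *\<^sub>v v) $ k = (\<Sum>a<n. A $$ (k, a) * v $ a)"
  using assms by (auto simp: scalar_prod_def atLeast0LessThan)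

lemma (in prob_space) expect_vec_mult_mat_vec:
  assumes F: "F \<in> carrier_mat m n" and x: "\<And>\<omega>. \<omega> \<in> space M \<Longrightarrow> x \<omega> \<in> carrier_vec n"
    and int: "\<And>a. a < n \<Longrightarrow> integrable M (\<lambda>\<omega>. x \<omega> $ a)"
    and y: "\<And>\<omega>. \<omega> \<in> space M \<Longrightarrow> y \<omega> = F *\<^sub>v x \<omega>"
  shows "expect_vec M m y = F *\<^sub>v expect_vec M n x"
proof (rule eq_vecI)
  have e: "expect_vec M n x \<in> carrier_vec n" by (simp add: expect_vec_def)
  show "dim_vec (expect_vec M m y) = dim_vec (F *\<^sub>v expect_vec M n x)"
    using F by (simp add: expect_vec_def)
  fix k assume "k < dim_vec (F *\<^sub>v expect_vec M n x)"
  then have k: "k < m" using F by simp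
  have "(LINT \<omega>|M. y \<omega> $ k) = (LINT \<omega>|M. (\<Sum>a<n. F $$ (k, a) * x \<omega> $ a))"
    using k by (intro Bochner_Integration.integral_cong) (auto simp: y index_mult_mat_vec_sum[OF F x])
  also have "\<dots> = (\<Sum>a<n. F $$ (k, a) * (LINT \<omega>|M. x \<omega> $ a))"
    using int by (simp add: Bochner_Integration.integral_sum)
  finally show "expect_vec M m y $ k = (F *\<^sub>v expect_vec M n x) $ k"
    using k by (simp add: index_mult_mat_vec_sum[OF F e k]) (simp add: expect_vec_def)
qed

lemma covariance_mat_carrier: "covariance_mat M n z \<in> carrier_mat n n"
  by (auto simp: covariance_mat_def col_times_row_def expect_vec_def)

lemma index_covariance_mat:
  assumes "\<And>\<omega>. \<omega> \<in> space M \<Longrightarrow> z \<omega> \<in> carrier_vec n" "k < n" "l < n"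
  shows "covariance_mat M n z $$ (k, l) =
    (LINT \<omega>|M. z \<omega> $ k * cnj (z \<omega> $ l)) - (LINT \<omega>|M. z \<omega> $ k) * (LINT \<omega>|M. cnj (z \<omega> $ l))"
proof -
  have dim: "dim_vec (z \<omega>) = n" if "\<omega> \<in> space M" for \<omega>
    using assms(1)[OF that] by simp
  have "(LINT \<omega>|M. col_times_row (z \<omega>) (conjugate (z \<omega>)) $$ (k, l)) = (LINT \<omega>|M. z \<omega> $ k * cnj (z \<omega> $ l))"
    using assms by (intro Bochner_Integration.integral_cong) (auto simp: col_times_row_def dim)
  moreover have "(LINT \<omega>|M. conjugate (z \<omega>) $ l) = (LINT \<omega>|M. cnj (z \<omega> $ l))"
    using assms by (intro Bochner_Integration.integral_cong) (auto simp: dim)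
  ultimately show ?thesis
    using assms(2,3) by (simp add: covariance_mat_def expect_mat_def expect_vec_def)
      (simp add: col_times_row_def)
qed

text \<open>Sesquilinearity read entrywise: row \<open>k\<close> of \<open>F\<close> supplies the
  coefficients of the first argument, and row \<open>l\<close>, conjugated, those of the
  second.\<close>

lemma (in prob_space) covariance_mat_mult_mat_vec:
  assumes F: "F \<in> carrier_mat m n" and x: "\<And>\<omega>. \<omega> \<in> space M \<Longrightarrow> x \<omega> \<in> carrier_vec n"
    and meas: "\<And>a. a < n \<Longrightarrow> (\<lambda>\<omega>. x \<omega> $ a) \<in> borel_measurable M"
    and int: "\<And>a. a < n \<Longrightarrow> integrable M (\<lambda>\<omega>. (cmod (x \<omega> $ a))\<^sup>2)"
    and y: "\<And>\<omega>. \<omega> \<in> space M \<Longrightarrow> y \<omega> = F *\<^sub>v x \<omega>"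
  shows "covariance_mat M m y = F * covariance_mat M n x * mat_adjoint F"
proof (rule eq_matI)
  note F' = mat_adjoint_carrier[OF F] and Cx = covariance_mat_carrier[of M n x]
    and Cy = covariance_mat_carrier[of M m y]
  show "dim_row (covariance_mat M m y) = dim_row (F * covariance_mat M n x * mat_adjoint F)"
    "dim_col (covariance_mat M m y) = dim_col (F * covariance_mat M n x * mat_adjoint F)"
    using F F' Cy by auto
  fix k l
  assume "k < dim_row (F * covariance_mat M n x * mat_adjoint F)"
    "l < dim_col (F * covariance_mat M n x * mat_adjoint F)"
  then have k: "k < m" and l: "l < m" using F F' by auto
  have yc: "y \<omega> \<in> carrier_vec m" if "\<omega> \<in> space M" for \<omega>
    using F x that by (simp add: y)
  have yk: "y \<omega> $ k = (\<Sum>a<n. F $$ (k, a) * x \<omega> $ a)" if "\<omega> \<in> space M" "k < m" for \<omega> k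
    using that by (simp add: y index_mult_mat_vec_sum[OF F x])
  have "covariance_mat M m y $$ (k, l) =
      (LINT \<omega>|M. (\<Sum>a<n. F $$ (k, a) * x \<omega> $ a) * cnj (\<Sum>b<n. F $$ (l, b) * x \<omega> $ b)) -
      (LINT \<omega>|M. (\<Sum>a<n. F $$ (k, a) * x \<omega> $ a)) * (LINT \<omega>|M. cnj (\<Sum>b<n. F $$ (l, b) * x \<omega> $ b))"
    by (subst index_covariance_mat[OF _ k l], fact yc, intro arg_cong2[where f = "(-)"] arg_cong2[where f = "(*)"] Bochner_Integration.integral_cong)
      (auto simp: yk k l simp del: cnj_sum)
  also have "\<dots> = (\<Sum>a<n. \<Sum>b<n. F $$ (k, a) * cnj (F $$ (l, b)) * covariance_mat M n x $$ (a, b))"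
    by (subst covariance_sum) (auto simp: meas int x index_covariance_mat)
  \<comment> \<open>With \<open>b\<close> outermost, the inner sum is an entry of
    \<open>F * covariance_mat M n x\<close> and the outer one is the product with the
    adjoint.\<close>
  also have "\<dots> = (\<Sum>b<n. (\<Sum>a<n. F $$ (k, a) * covariance_mat M n x $$ (a, b)) * cnj (F $$ (l, b)))"
    by (subst sum.swap) (simp add: sum_distrib_left mult_ac)
  also have "\<dots> = (F * covariance_mat M n x * mat_adjoint F) $$ (k, l)"
    using F F' Cx k l
    by (auto simp: scalar_prod_def atLeast0LessThan index_mat_adjoint simp del: assoc_mult_mat intro!: sum.cong)
  finally show "covariance_mat M m y $$ (k, l) = (F * covariance_mat M n x * mat_adjoint F) $$ (k, l)" .
qed

section \<open>Vectorization, localization and spectral densities\<close>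

lemma vec_of_mat_of_vec:
  assumes "v \<in> carrier_vec (N * T)"
  shows "vec_of_mat (mat_of_vec N T v) = v"
  using assms
  by (intro eq_vecI) (auto simp: vec_of_mat_def mat_of_vec_def mod_less_nat[of _ T N] div_less_nat[of _ T N] mult.commute[of N T])

text \<open>Since \<open>i < N\<close>, the index \<open>N * t + i\<close> is the only one with
  quotient \<open>t\<close> and remainder \<open>i\<close>. Localization thereby becomes the choice
  of a column of the filter.\<close>

lemma kron_vec_unit_vec:
  assumes "t < T" "i < N"
  shows "kron_vec (unit_vec T t) (unit_vec N i) = (unit_vec (N * T) (N * t + i) :: 'a :: semiring_1 vec)"
proof (rule eq_vecI)
  fix k assume "k < dim_vec (unit_vec (N * T) (N * t + i) :: 'a vec)"
  then have k: "k < T * N" by (simp add: mult.commute)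
  have "k div N = t \<and> k mod N = i \<longleftrightarrow> k = N * t + i"
    using assms by auto
  then show "kron_vec (unit_vec T t) (unit_vec N i) $ k = (unit_vec (N * T) (N * t + i) :: 'a vec) $ k"
    using k mod_less_nat[OF k] div_less_nat[OF k] mult_add_less_nat[OF assms]
    by (auto simp: kron_vec_def unit_vec_def mult.commute)
qed (simp add: kron_vec_def mult.commute)

lemma joint_filter_carrier:
  assumes "UG \<in> carrier_mat N N"
  shows "joint_filter N T UG lam h \<in> carrier_mat (N * T) (N * T)"
proof -
  have U: "joint_fourier T UG \<in> carrier_mat (N * T) (N * T)"
    using kron_mat_carrier[OF _ assms, of "time_fourier T" T T]
    by (simp add: joint_fourier_def time_fourier_def mult.commute)
  show ?thesis
    using U mat_adjoint_carrier[OF U] by (simp add: joint_filter_def mult_square_mat)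
qed

text \<open>Localizing at \<open>(i, t)\<close> yields column \<open>N * t + i\<close> of the
  filter, and every column index has this form. The columnwise definition is therefore one matrix
  equation, to which matrix algebra applies.\<close>

lemma is_jpsd_iff:
  assumes UG: "UG \<in> carrier_mat N N"
  shows "is_jpsd M N T UG lam Z h \<longleftrightarrow>
    covariance_mat M (N * T) (\<lambda>\<omega>. vec_of_mat (Z \<omega>)) = joint_filter N T UG lam h"
proof -
  let ?C = "covariance_mat M (N * T) (\<lambda>\<omega>. vec_of_mat (Z \<omega>))" and ?H = "joint_filter N T UG lam h"
  note H = joint_filter_carrier[OF UG, of T lam h]
  have loc: "vec_of_mat (joint_localization N T UG lam i t h) = col ?H (N * t + i)"
    if "i < N" "t < T" for i t
  proof -
    have lt: "N * t + i < N * T"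
      using mult_add_less_nat[OF that(2,1)] by (simp add: mult.commute)
    show ?thesis
      using H lt that mult_mat_vec_carrier[OF H]
      by (auto simp: joint_localization_def kron_vec_unit_vec vec_of_mat_of_vec intro!: eq_vecI)
  qed
  have "(\<forall>i<N. \<forall>t<T. col ?C (N * t + i) = col ?H (N * t + i)) \<longleftrightarrow> ?C = ?H"
  proof
    assume *: "\<forall>i<N. \<forall>t<T. col ?C (N * t + i) = col ?H (N * t + i)"
    have "col ?C k = col ?H k" if "k < N * T" for k
      using *[rule_format, of "k mod N" "k div N"] that mod_less_nat[of k T N] div_less_nat[of k T N]
      by (simp add: mult.commute)
    then show "?C = ?H"
      using H covariance_mat_carrier[of M "N * T"] by (intro mat_col_eqI) auto
  qed simp
  then show ?thesis by (simp add: is_jpsd_def loc)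
qed

text \<open>The filter with response \<open>f\<close> is its own adjoint, and all three factors
  share one unitary basis, so the responses multiply to \<open>f * h * f\<close>.\<close>

lemma joint_filter_sandwich:
  assumes "T \<ge> 1" "unitary_mat N UG"
  shows "joint_filter N T UG lam f * joint_filter N T UG lam h * mat_adjoint (joint_filter N T UG lam f) =
    joint_filter N T UG lam (\<lambda>\<mu> \<omega>. (f \<mu> \<omega>)\<^sup>2 * h \<mu> \<omega>)"
proof -
  note U = unitary_joint_fourier[OF assms]
  then have Uc: "joint_fourier T UG \<in> carrier_mat (N * T) (N * T)" by (simp add: unitary_mat_def)
  have "(\<lambda>k. complex_of_real (f (lam (k mod N)) (ang_freq T (k div N))) *
      complex_of_real (h (lam (k mod N)) (ang_freq T (k div N))) *
      complex_of_real (f (lam (k mod N)) (ang_freq T (k div N)))) =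
    (\<lambda>k. complex_of_real ((f (lam (k mod N)) (ang_freq T (k div N)))\<^sup>2 * h (lam (k mod N)) (ang_freq T (k div N))))"
    by (auto simp: power2_eq_square)
  then show ?thesis
    by (simp only: joint_filter_def mat_adjoint_mult_mat_diag_mult[OF Uc] unitary_mult_mat_diag_mult[OF U])
qed

section \<open>Entries of vectorized processes and the filtered process\<close>

lemma index_vec_of_mat:
  assumes "Z \<in> carrier_mat N T" "i < N" "t < T"
  shows "vec_of_mat Z $ (N * t + i) = Z $$ (i, t)"
  using assms mult_add_less_nat[OF assms(3,2)] by (auto simp: vec_of_mat_def mult.commute)

lemma index_vec_of_mat_div_mod:
  assumes "Z \<in> carrier_mat N T" "k < N * T"
  shows "vec_of_mat Z $ k = Z $$ (k mod N, k div N)"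
  using assms by (simp add: vec_of_mat_def)

lemma vec_of_mat_carrier: "Z \<in> carrier_mat N T \<Longrightarrow> vec_of_mat Z \<in> carrier_vec (N * T)"
  by (auto simp: vec_of_mat_def)

theorem theorem3:
  fixes M :: "'w measure" and N T :: nat
    and W :: "real mat" and UG :: "complex mat" and lam :: "nat \<Rightarrow> real"
    and X Y :: "'w \<Rightarrow> complex mat" and hX f :: "real \<Rightarrow> real \<Rightarrow> real"
  assumes "prob_space M"
    and "T \<ge> 1"
    and "weighted_graph N W"
    and "laplacian_eigendecomposition N W UG lam"
    and "jwss M N T W UG lam X"
    and "\<forall>\<omega>\<in>space M. \<forall>i<N. \<forall>t<T. X \<omega> $$ (i, t) \<in> \<real>"
    and "is_jpsd M N T UG lam X hX"
    and "\<forall>\<omega>\<in>space M. Y \<omega> \<in> carrier_mat N T \<and>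
           vec_of_mat (Y \<omega>) = joint_filter N T UG lam f *\<^sub>v vec_of_mat (X \<omega>)"
  shows "jwss M N T W UG lam Y \<and>
         expect_mat M N T Y = complex_of_real (f 0 0) \<cdot>\<^sub>m expect_mat M N T X \<and>
         is_jpsd M N T UG lam Y (\<lambda>\<mu> \<omega>. (f \<mu> \<omega>)\<^sup>2 * hX \<mu> \<omega>)"
proof -
  interpret prob_space M by fact
  let ?n = "N * T" and ?F = "joint_filter N T UG lam f"
  let ?x = "\<lambda>\<omega>. vec_of_mat (X \<omega>)" and ?y = "\<lambda>\<omega>. vec_of_mat (Y \<omega>)"
  let ?L = "joint_laplacian N T W"
  have unitary: "unitary_mat N UG" and UG: "UG \<in> carrier_mat N N"
    using assms(4) by (auto simp: laplacian_eigendecomposition_def unitary_mat_def)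
  note F = joint_filter_carrier[OF UG, of T lam f]
  have X: "time_vertex_process M N T X" and mean0: "?L *\<^sub>v expect_vec M ?n ?x = 0\<^sub>v ?n"
    using assms(5) by (auto simp: jwss_def)
  have Xc: "X \<omega> \<in> carrier_mat N T" if "\<omega> \<in> space M" for \<omega>
    using X that by (simp add: time_vertex_process_def)
  have Yc: "Y \<omega> \<in> carrier_mat N T" and y: "?y \<omega> = ?F *\<^sub>v ?x \<omega>" if "\<omega> \<in> space M" for \<omega>
    using assms(8) that by auto
  note x = vec_of_mat_carrier[OF Xc]
  \<comment> \<open>The process is constrained entrywise, so its properties are moved to vector
    positions. The entries agree only on \<open>space M\<close>, which calls for congruence
    rules.\<close>
  have meas: "(\<lambda>\<omega>. ?x \<omega> $ k) \<in> borel_measurable M"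
    and int: "integrable M (\<lambda>\<omega>. (cmod (?x \<omega> $ k))\<^sup>2)" if k: "k < ?n" for k
  proof -
    have kk: "k mod N < N" "k div N < T"
      using k mod_less_nat[of k T N] div_less_nat[of k T N] by (auto simp: mult.commute)
    have eq: "?x \<omega> $ k = X \<omega> $$ (k mod N, k div N)" if "\<omega> \<in> space M" for \<omega>
      using index_vec_of_mat_div_mod[OF Xc[OF that] k] .
    show "(\<lambda>\<omega>. ?x \<omega> $ k) \<in> borel_measurable M"
      using X kk eq by (subst measurable_cong[OF eq]) (auto simp: time_vertex_process_def)
    show "integrable M (\<lambda>\<omega>. (cmod (?x \<omega> $ k))\<^sup>2)"
      using X kk
      by (subst Bochner_Integration.integrable_cong[OF refl, where g = "\<lambda>\<omega>. (cmod (X \<omega> $$ (k mod N, k div N)))\<^sup>2"])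
        (auto simp: time_vertex_process_def eq)
  qed
  have mean: "expect_vec M ?n ?y = complex_of_real (f 0 0) \<cdot>\<^sub>v expect_vec M ?n ?x"
  proof -
    have "expect_vec M ?n ?y = ?F *\<^sub>v expect_vec M ?n ?x"
      using square_integrable_imp_integrable_complex[OF meas int]
      by (intro expect_vec_mult_mat_vec[OF F x _ y]) auto
    also have "\<dots> = complex_of_real (f 0 0) \<cdot>\<^sub>v expect_vec M ?n ?x"
      using mean0 by (intro joint_filter_kernel_joint_laplacian[OF assms(2,3,4)]) (auto simp: expect_vec_def)
    finally show ?thesis .
  qed
  have entry: "expect_vec M ?n (\<lambda>\<omega>. vec_of_mat (Z \<omega>)) $ (N * t + i) = expect_mat M N T Z $$ (i, t)"
    if "i < N" "t < T" "\<And>\<omega>. \<omega> \<in> space M \<Longrightarrow> Z \<omega> \<in> carrier_mat N T" for Z i t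
  proof -
    have "(LINT \<omega>|M. vec_of_mat (Z \<omega>) $ (N * t + i)) = (LINT \<omega>|M. Z \<omega> $$ (i, t))"
      using that by (intro Bochner_Integration.integral_cong) (auto simp: index_vec_of_mat[where T = T])
    then show ?thesis
      using mult_add_less_nat[OF that(2,1)] that(1,2)
      by (simp add: expect_vec_def expect_mat_def mult.commute)
  qed
  \<comment> \<open>The mean identity holds for the vectorized processes; \<open>entry\<close>
    carries it back to matrices.\<close>
  have "expect_mat M N T Y = complex_of_real (f 0 0) \<cdot>\<^sub>m expect_mat M N T X"
  proof (rule eq_matI)
    fix i t
    assume "i < dim_row (complex_of_real (f 0 0) \<cdot>\<^sub>m expect_mat M N T X)"
      "t < dim_col (complex_of_real (f 0 0) \<cdot>\<^sub>m expect_mat M N T X)"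
    then have it: "i < N" "t < T" by (auto simp: expect_mat_def)
    then have "N * t + i < ?n" using mult_add_less_nat[OF it(2,1)] by (simp add: mult.commute)
    then have "expect_vec M ?n ?y $ (N * t + i) = complex_of_real (f 0 0) * expect_vec M ?n ?x $ (N * t + i)"
      unfolding mean by (simp add: expect_vec_def)
    then show "expect_mat M N T Y $$ (i, t) = (complex_of_real (f 0 0) \<cdot>\<^sub>m expect_mat M N T X) $$ (i, t)"
      using it by (simp add: entry Xc Yc) (simp add: expect_mat_def)
  qed (simp_all add: expect_mat_def)
  \<comment> \<open>As matrices, the covariance of \<open>Y\<close> is the filter for
    \<open>f\<close> times that for \<open>hX\<close> times the adjoint of the first.\<close>
  moreover have jpsd: "is_jpsd M N T UG lam Y (\<lambda>\<mu> \<omega>. (f \<mu> \<omega>)\<^sup>2 * hX \<mu> \<omega>)"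
    using assms(7) covariance_mat_mult_mat_vec[OF F x meas int y]
    by (simp add: is_jpsd_iff[OF UG] joint_filter_sandwich[OF assms(2) unitary])
  moreover have "jwss M N T W UG lam Y"
  proof -
    \<comment> \<open>\<open>Y\<close> is given only through its vectorization. Writing its entries
      as finite combinations of those of \<open>X\<close> yields their measurability and finite
      second moments.\<close>
    have ind: "Y \<omega> $$ (i, t) = (\<Sum>a<?n. ?F $$ (N * t + i, a) * ?x \<omega> $ a)"
      if "i < N" "t < T" "\<omega> \<in> space M" for i t \<omega>
      using index_vec_of_mat[OF Yc[OF that(3)] that(1,2)] index_mult_mat_vec_sum[OF F x[OF that(3)], of "N * t + i"]
        mult_add_less_nat[OF that(2,1)] y[OF that(3)]
      by (simp add: mult.commute[of N])
    have "(\<lambda>\<omega>. Y \<omega> $$ (i, t)) \<in> borel_measurable M" if "i < N" "t < T" for i t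
      using meas by (subst measurable_cong[OF ind[OF that]]) auto
    moreover have "integrable M (\<lambda>\<omega>. (cmod (Y \<omega> $$ (i, t)))\<^sup>2)" if "i < N" "t < T" for i t
    proof -
      have "integrable M (\<lambda>\<omega>. (cmod (\<Sum>a<?n. ?F $$ (N * t + i, a) * ?x \<omega> $ a))\<^sup>2)"
        by (intro square_integrable_sum meas int)
      then show ?thesis
        by (subst Bochner_Integration.integrable_cong[OF refl arg_cong[OF ind[OF that]]])
    qed
    ultimately have "time_vertex_process M N T Y" by (simp add: time_vertex_process_def Yc)
    moreover have "?L *\<^sub>v expect_vec M ?n ?y = 0\<^sub>v ?n"
    proof -
      have L: "?L \<in> carrier_mat ?n ?n"
        using assms(3) by (auto simp: joint_laplacian_def kron_mat_def graph_laplacian_def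
            weighted_graph_def mult.commute)
      \<comment> \<open>The mean of \<open>Y\<close> is a scalar multiple of that of
        \<open>X\<close>, hence in the same kernel.\<close>
      have "?L *\<^sub>v expect_vec M ?n ?y = complex_of_real (f 0 0) \<cdot>\<^sub>v (?L *\<^sub>v expect_vec M ?n ?x)"
        unfolding mean by (rule mult_mat_vec[OF L]) (simp add: expect_vec_def)
      then show ?thesis by (auto simp: mean0 intro!: eq_vecI)
    qed
    ultimately show ?thesis using jpsd unfolding jwss_def by blast
  qed
  ultimately show ?thesis by blast
qed

end
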